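(* Let $K\ge1$ be fixed and, for each $n$, suppose the $n\times1$ vector of excess returns satisfies $\mathbf r_t=\mathbf B_n\boldsymbol\phi+\mathbf B_n\mathbf f_t+\mathbf u_t$, where $\boldsymbol\phi\in\mathbb R^K$ with $\boldsymbol\phi'\boldsymbol\phi>0$, $\mathbf f_t$ is a $K\times 1$ vector of factors with mean $\boldsymbol\mu$ and positive definite covariance matrix $\boldsymbol\Sigma_f$, $\mathbf B_n$ is a non-random $n\times K$ matrix, $\mathbf u_t$ has mean zero and positive definite covariance matrix $\mathbf V_u$ and is uncorrelated with $\mathbf f_t$, and $\mathbf B_n'\mathbf V_u^{-1}\mathbf B_n$ is invertible. Let $\boldsymbol\lambda=\boldsymbol\mu+\boldsymbol\phi$. Consider the phi-portfolio return $$\rho_{t,\phi}=\boldsymbol\phi'\left[(\mathbf B_n'\mathbf V_u^{-1}\mathbf B_n)^{-1}\mathbf B_n'\mathbf V_u^{-1}\mathbf r_t-\mathbf f_t\right].$$ Its squared Sharpe ratio is $$SR_\phi^2=\frac{(\boldsymbol\phi'\boldsymbol\phi)^2}{\boldsymbol\phi'(\mathbf B_n'\mathbf V_u^{-1}\mathbf B_n)^{-1}\boldsymbol\phi}\;\ge\;(\boldsymbol\phi'\boldsymbol\phi)\,\lambda_{\min}(\mathbf B_n'\mathbf V_u^{-1}\mathbf B_n),$$ whereas the squared Sharpe ratio of the mean-variance portfolio, $SR_{MV}^2=\boldsymbol\mu_R'\mathbf V_R^{-1}\boldsymbol\mu_R$ with $\boldsymbol\mu_R=\mathbf B_n\boldsymbol\lambda$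 and $\mathbf V_R=\mathbf B_n\boldsymbol\Sigma_f\mathbf B_n'+\mathbf V_u$, satisfies $$SR_{MV}^2\le\boldsymbol\lambda'\boldsymbol\Sigma_f^{-1}\boldsymbol\lambda=(\boldsymbol\mu+\boldsymbol\phi)'\boldsymbol\Sigma_f^{-1}(\boldsymbol\mu+\boldsymbol\phi)$$ for all $n$. Consequently, if $\lambda_{\min}(\mathbf B_n'\mathbf V_u^{-1}\mathbf B_n)\to\infty$ as $n\to\infty$, then $SR_\phi^2\to\infty$ while $SR_{MV}^2$ remains bounded in $n$, so that $SR_\phi^2>SR_{MV}^2$ for all sufficiently large $n$.
   Context: The squared Sharpe ratio of a (excess) return $\rho$ is $[E(\rho)]^2/Var(\rho)$. $\lambda_{\min}(\cdot)$ is the smallest eigenvalue of a symmetric matrix. The mean-variance portfolio return is $\rho_{MV,t}=\boldsymbol\mu_R'\mathbf V_R^{-1}\mathbf r_t$. The quantities $\boldsymbol\phi,\boldsymbol\mu,\boldsymbol\Sigma_f$ and $K$ do not depend on $n$. *)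

theory Defs
  imports
    "HOL-Probability.Probability"
    "Jordan_Normal_Form.Gauss_Jordan_Elimination"
    "Jordan_Normal_Form.Spectral_Radius"
begin

(* Vectors and matrices are those of Jordan_Normal_Form, whose dimensions are ordinary naturals,
   because the number of assets n varies inside the statement. *)
unbundle no inner_syntax
unbundle no vec_syntax
hide_const (open) Finite_Cartesian_Product.vec

(* Meaningful for invertible square matrices only. *)
definition mat_inv :: "real mat \<Rightarrow> real mat" where
  "mat_inv A = the (mat_inverse A)"

definition pos_def_mat :: "nat \<Rightarrow> real mat \<Rightarrow> bool" where
  "pos_def_mat d A \<longleftrightarrow> A \<in> carrier_mat d d \<and> transpose_mat A = A \<and>
     (\<forall>x \<in> carrier_vec d. x \<noteq> 0\<^sub>v d \<longrightarrow> x \<bullet> (A *\<^sub>v x) > 0)"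

definition lambda_min :: "real mat \<Rightarrow> real" where
  "lambda_min A = Min (spectrum A)"

(* Square integrability is what makes the means and covariances below exist. *)
definition random_vec :: "'a measure \<Rightarrow> nat \<Rightarrow> ('a \<Rightarrow> real vec) \<Rightarrow> bool" where
  "random_vec M d X \<longleftrightarrow> (\<forall>\<omega> \<in> space M. X \<omega> \<in> carrier_vec d) \<and>
     (\<forall>i<d. (\<lambda>\<omega>. X \<omega> $ i) \<in> borel_measurable M \<and> integrable M (\<lambda>\<omega>. (X \<omega> $ i)\<^sup>2))"

definition covariance :: "'a measure \<Rightarrow> ('a \<Rightarrow> real) \<Rightarrow> ('a \<Rightarrow> real) \<Rightarrow> real" where
  "covariance M X Y = prob_space.expectation M
     (\<lambda>\<omega>. (X \<omega> - prob_space.expectation M X) * (Y \<omega> - prob_space.expectation M Y))"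

definition mean_vec :: "'a measure \<Rightarrow> nat \<Rightarrow> ('a \<Rightarrow> real vec) \<Rightarrow> real vec" where
  "mean_vec M d X = Matrix.vec d (\<lambda>i. prob_space.expectation M (\<lambda>\<omega>. X \<omega> $ i))"

definition cov_mat :: "'a measure \<Rightarrow> nat \<Rightarrow> ('a \<Rightarrow> real vec) \<Rightarrow> real mat" where
  "cov_mat M d X = mat d d (\<lambda>(i, j). covariance M (\<lambda>\<omega>. X \<omega> $ i) (\<lambda>\<omega>. X \<omega> $ j))"

definition uncorrelated ::
  "'a measure \<Rightarrow> nat \<Rightarrow> ('a \<Rightarrow> real vec) \<Rightarrow> nat \<Rightarrow> ('a \<Rightarrow> real vec) \<Rightarrow> bool" where
  "uncorrelated M d X e Y \<longleftrightarrow>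
     (\<forall>i<d. \<forall>j<e. covariance M (\<lambda>\<omega>. X \<omega> $ i) (\<lambda>\<omega>. Y \<omega> $ j) = 0)"

definition squared_sharpe :: "'a measure \<Rightarrow> ('a \<Rightarrow> real) \<Rightarrow> real" where
  "squared_sharpe M X = (prob_space.expectation M X)\<^sup>2 / prob_space.variance M X"

definition info_mat :: "real mat \<Rightarrow> real mat \<Rightarrow> real mat" where
  "info_mat B Vu = transpose_mat B * mat_inv Vu * B"

(* The cross-section of n excess returns at one date; B is non-random because it does not depend
   on the sample point. *)
locale factor_model = prob_space M for M :: "'a measure" +
  fixes n K :: nat
    and \<phi> \<mu> :: "real vec" and Sf B Vu :: "real mat"
    and f u r :: "'a \<Rightarrow> real vec"
  assumes f_random: "random_vec M K f"
    and f_mean: "mean_vec M K f = \<mu>"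
    and f_cov: "cov_mat M K f = Sf"
    and Sf_pos_def: "pos_def_mat K Sf"
    and B_carrier: "B \<in> carrier_mat n K"
    and u_random: "random_vec M n u"
    and u_mean: "mean_vec M n u = 0\<^sub>v n"
    and u_cov: "cov_mat M n u = Vu"
    and Vu_pos_def: "pos_def_mat n Vu"
    and f_u_uncorrelated: "uncorrelated M K f n u"
    and info_invertible: "invertible_mat (info_mat B Vu)"
    and returns: "\<And>\<omega>. \<omega> \<in> space M \<Longrightarrow> r \<omega> = B *\<^sub>v \<phi> + B *\<^sub>v f \<omega> + u \<omega>"

definition phi_return ::
  "real vec \<Rightarrow> real mat \<Rightarrow> real mat \<Rightarrow> ('a \<Rightarrow> real vec) \<Rightarrow> ('a \<Rightarrow> real vec) \<Rightarrow> 'a \<Rightarrow> real" where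
  "phi_return \<phi> B Vu f r \<omega> =
     \<phi> \<bullet> ((mat_inv (info_mat B Vu) * transpose_mat B * mat_inv Vu) *\<^sub>v r \<omega> - f \<omega>)"

definition mv_return :: "'a measure \<Rightarrow> nat \<Rightarrow> ('a \<Rightarrow> real vec) \<Rightarrow> 'a \<Rightarrow> real" where
  "mv_return M n r \<omega> = mean_vec M n r \<bullet> (mat_inv (cov_mat M n r) *\<^sub>v r \<omega>)"

end

theory Submission
  imports Defs
begin

text \<open>Write \<open>A = B' V\<^sub>u\<^sup>-\<^sup>1 B\<close>. The weights of the phi-portfolio reproduce the factors exactly, so its
  return is \<open>\<phi> \<bullet> \<phi> + w \<bullet> u\<close> with \<open>w = V\<^sub>u\<^sup>-\<^sup>1 B A\<^sup>-\<^sup>1 \<phi>\<close>, whose variance is \<open>\<phi> \<bullet> A\<^sup>-\<^sup>1 \<phi>\<close>; the Rayleigh bound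
  for \<open>A\<close> then bounds the Sharpe ratio from below. For the mean-variance portfolio put \<open>w = V\<^sub>R\<^sup>-\<^sup>1 \<mu>\<^sub>R\<close>,
  \<open>z = B' w\<close> and \<open>s = SR\<^sub>M\<^sub>V\<^sup>2 = w \<bullet> V\<^sub>R w = z \<bullet> \<lambda>\<close>. Since \<open>z \<bullet> \<Sigma>\<^sub>f z \<le> w \<bullet> V\<^sub>R w\<close>, Cauchy--Schwarz gives
  \<open>s\<^sup>2 \<le> (z \<bullet> \<Sigma>\<^sub>f z) (\<lambda> \<bullet> \<Sigma>\<^sub>f\<^sup>-\<^sup>1 \<lambda>) \<le> s (\<lambda> \<bullet> \<Sigma>\<^sub>f\<^sup>-\<^sup>1 \<lambda>)\<close>.\<close>

subsection \<open>Quadratic forms of symmetric matrices\<close>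

lemma symmetric_form:
  fixes A :: "real mat"
  assumes A: "A \<in> carrier_mat d d" "transpose_mat A = A"
    and xy: "x \<in> carrier_vec d" "y \<in> carrier_vec d"
  shows "x \<bullet> (A *\<^sub>v y) = y \<bullet> (A *\<^sub>v x)"
  using transpose_vec_mult_scalar[OF A(1) xy(2,1)] A xy
  by (simp add: comm_scalar_prod[of _ d])

text \<open>The form at \<open>x + t y\<close> is a quadratic in \<open>t\<close> that never becomes
  negative. Since \<open>A\<close> is only semidefinite, the leading coefficient \<open>c\<close>
  may vanish and is treated separately.\<close>

lemma psd_Cauchy_Schwarz:
  fixes A :: "real mat"
  assumes A: "A \<in> carrier_mat d d" "transpose_mat A = A"
    and psd: "\<And>x. x \<in> carrier_vec d \<Longrightarrow> 0 \<le> x \<bullet> (A *\<^sub>v x)"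
    and x: "x \<in> carrier_vec d" and y: "y \<in> carrier_vec d"
  shows "(x \<bullet> (A *\<^sub>v y))\<^sup>2 \<le> (x \<bullet> (A *\<^sub>v x)) * (y \<bullet> (A *\<^sub>v y))"
proof -
  define a b c where "a = x \<bullet> (A *\<^sub>v x)" "b = x \<bullet> (A *\<^sub>v y)" "c = y \<bullet> (A *\<^sub>v y)"
  have q: "0 \<le> a + 2 * t * b + t\<^sup>2 * c" for t
  proof -
    have "(x + t \<cdot>\<^sub>v y) \<bullet> (A *\<^sub>v (x + t \<cdot>\<^sub>v y)) = a + t * b + t * (y \<bullet> (A *\<^sub>v x)) + t * (t * c)"
      using A(1) x y
      by (simp add: a_b_c_def mult_add_distrib_mat_vec[of _ d d] mult_mat_vec[of _ d d] add_scalar_prod_distrib[of _ d]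
          scalar_prod_add_distrib[of _ d] algebra_simps)
    also have "y \<bullet> (A *\<^sub>v x) = b"
      using symmetric_form[OF A y x] by (simp add: a_b_c_def)
    finally have "(x + t \<cdot>\<^sub>v y) \<bullet> (A *\<^sub>v (x + t \<cdot>\<^sub>v y)) = a + 2 * t * b + t\<^sup>2 * c"
      by (simp add: power2_eq_square)
    with psd[of "x + t \<cdot>\<^sub>v y"] x y show ?thesis by simp
  qed
  have c: "0 \<le> c" using psd[OF y] by (simp add: a_b_c_def)
  have "b\<^sup>2 \<le> a * c"
  proof (cases "c = 0")
    case True
    \<comment> \<open>For \<open>c = 0\<close> the quadratic is affine in \<open>t\<close>; at this
      point it equals -1 unless \<open>b = 0\<close>.\<close>
    with q[of "- (a + 1) / (2 * b)"] have "b = 0" by (cases "b = 0") (simp_all add: field_simps)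
    with True show ?thesis by simp
  next
    case False
    \<comment> \<open>The point \<open>- b / c\<close> minimises the quadratic, with minimum
      \<open>a - b^2 / c\<close>.\<close>
    with c q[of "- b / c"] show ?thesis
      by (simp add: field_simps power2_eq_square)
  qed
  then show ?thesis by (simp add: a_b_c_def)
qed

lemma scalar_prod_self_nonneg: "0 \<le> (x :: real vec) \<bullet> x"
  unfolding scalar_prod_def by (intro sum_nonneg) simp

lemma scalar_prod_self_eq_0:
  fixes x :: "real vec"
  assumes x: "x \<in> carrier_vec d" and "x \<bullet> x = 0"
  shows "x = 0\<^sub>v d"
proof
  fix i assume "i < dim_vec (0\<^sub>v d :: real vec)"
  then show "x $ i = (0\<^sub>v d :: real vec) $ i"
    using assms by (auto simp: scalar_prod_def sum_nonneg_eq_0_iff)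
qed (use x in simp)

text \<open>The constant is the sum of the absolute entries, since each
  \<open>\<bar>x $ i * x $ j\<bar>\<close> is at most \<open>x \<bullet> x\<close>. It later bounds
  the form of an inverse matrix and supplies a first lower bound for the form of
  \<open>A\<close>.\<close>

lemma quadratic_form_bounded:
  fixes A :: "real mat"
  assumes A: "A \<in> carrier_mat d d"
  obtains c where "0 \<le> c" "\<And>x. x \<in> carrier_vec d \<Longrightarrow> \<bar>x \<bullet> (A *\<^sub>v x)\<bar> \<le> c * (x \<bullet> x)"
proof
  show "0 \<le> (\<Sum>i<d. \<Sum>j<d. \<bar>A $$ (i, j)\<bar>)" by (intro sum_nonneg) simp
  fix x :: "real vec" assume x: "x \<in> carrier_vec d"
  have sq: "(x $ i)\<^sup>2 \<le> x \<bullet> x" if "i < d" for i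
    using x that member_le_sum[of i "{0..<d}" "\<lambda>i. (x $ i)\<^sup>2"]
    by (simp add: scalar_prod_def power2_eq_square)
  have "\<bar>x \<bullet> (A *\<^sub>v x)\<bar> = \<bar>\<Sum>i<d. \<Sum>j<d. A $$ (i, j) * (x $ i * x $ j)\<bar>"
    using A x by (simp add: scalar_prod_def sum_distrib_left mult_ac atLeast0LessThan)
  also have "\<dots> \<le> (\<Sum>i<d. \<Sum>j<d. \<bar>A $$ (i, j) * (x $ i * x $ j)\<bar>)"
    by (intro order_trans[OF sum_abs] sum_mono sum_abs)
  also have "\<dots> \<le> (\<Sum>i<d. \<Sum>j<d. \<bar>A $$ (i, j)\<bar> * (x \<bullet> x))"
  proof (intro sum_mono)
    fix i j assume ij: "i \<in> {..<d}" "j \<in> {..<d}"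
    have "2 * \<bar>x $ i * x $ j\<bar> \<le> (x $ i)\<^sup>2 + (x $ j)\<^sup>2"
      using sum_squares_bound[of "\<bar>x $ i\<bar>" "\<bar>x $ j\<bar>"] by (simp add: abs_mult)
    with sq[of i] sq[of j] ij have "\<bar>x $ i * x $ j\<bar> \<le> x \<bullet> x" by simp
    then show "\<bar>A $$ (i, j) * (x $ i * x $ j)\<bar> \<le> \<bar>A $$ (i, j)\<bar> * (x \<bullet> x)"
      unfolding abs_mult[of "A $$ (i, j)"] by (rule mult_left_mono) simp
  qed
  also have "\<dots> = (\<Sum>i<d. \<Sum>j<d. \<bar>A $$ (i, j)\<bar>) * (x \<bullet> x)"
    by (simp add: sum_distrib_right)
  finally show "\<bar>x \<bullet> (A *\<^sub>v x)\<bar> \<le> (\<Sum>i<d. \<Sum>j<d. \<bar>A $$ (i, j)\<bar>) * (x \<bullet> x)" .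
qed

section \<open>Inverse matrices and coercivity\<close>

lemma mat_inv_inverts:
  assumes A: "A \<in> carrier_mat d d" and det: "det A \<noteq> 0"
  shows "A * mat_inv A = 1\<^sub>m d" "mat_inv A * A = 1\<^sub>m d" "mat_inv A \<in> carrier_mat d d"
proof -
  \<comment> \<open>The argument \<open>b\<close> only fills the extension slot of the record
    \<open>ring_mat\<close>; fixing it makes both facts speak of the same ring.\<close>
  have "mat_inverse A \<noteq> None"
    using mat_inverse(1)[OF A, where b = "()"] det_non_zero_imp_unit[OF A det, where b = "()"] by blast
  then obtain C where "mat_inverse A = Some C" by blast
  with mat_inverse(2)[OF A this]
  show "A * mat_inv A = 1\<^sub>m d" "mat_inv A * A = 1\<^sub>m d" "mat_inv A \<in> carrier_mat d d"
    by (simp_all add: mat_inv_def)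
qed

lemma mat_inv_mult_vec:
  assumes A: "A \<in> carrier_mat d d" and det: "det A \<noteq> 0" and x: "x \<in> carrier_vec d"
  shows "A *\<^sub>v (mat_inv A *\<^sub>v x) = x" "mat_inv A *\<^sub>v (A *\<^sub>v x) = x"
  using mat_inv_inverts[OF A det] A x
  by (metis assoc_mult_mat_vec one_mult_mat_vec)+

text \<open>Cauchy--Schwarz for the form of \<open>A\<close> at \<open>x\<close> and \<open>A\<^sup>-\<^sup>1 x\<close> gives \<open>(x \<bullet> x)\<^sup>2 \<le> (x \<bullet> A x) (x \<bullet> A\<^sup>-\<^sup>1 x)\<close>,
  and the last factor is at most a multiple of \<open>x \<bullet> x\<close>.\<close>

lemma psd_invertible_coercive:
  fixes A :: "real mat"
  assumes A: "A \<in> carrier_mat d d" "transpose_mat A = A"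
    and psd: "\<And>x. x \<in> carrier_vec d \<Longrightarrow> 0 \<le> x \<bullet> (A *\<^sub>v x)"
    and det: "det A \<noteq> 0"
  obtains e where "0 < e" "\<And>x. x \<in> carrier_vec d \<Longrightarrow> e * (x \<bullet> x) \<le> x \<bullet> (A *\<^sub>v x)"
proof -
  note inv = mat_inv_inverts[OF A(1) det]
  obtain c where c: "0 \<le> c" "\<And>x. x \<in> carrier_vec d \<Longrightarrow> \<bar>x \<bullet> (mat_inv A *\<^sub>v x)\<bar> \<le> c * (x \<bullet> x)"
    using quadratic_form_bounded[OF inv(3)] by metis
  \<comment> \<open>The bound \<open>c\<close> may be 0, so \<open>c + 1\<close> is used to keep the
    coercivity constant well defined and positive.\<close>
  have "1 / (c + 1) * (x \<bullet> x) \<le> x \<bullet> (A *\<^sub>v x)" if x: "x \<in> carrier_vec d" for x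
  proof (cases "x \<bullet> x = 0")
    case True
    with psd[OF x] show ?thesis by simp
  next
    case False
    then have pos: "0 < x \<bullet> x" using scalar_prod_self_nonneg[of x] by simp
    define y where "y = mat_inv A *\<^sub>v x"
    have y: "y \<in> carrier_vec d" using inv(3) x by (simp add: y_def)
    have Ay: "A *\<^sub>v y = x" using mat_inv_mult_vec[OF A(1) det x] by (simp add: y_def)
    have "(x \<bullet> x) * (x \<bullet> x) \<le> (x \<bullet> (A *\<^sub>v x)) * (y \<bullet> x)"
      using psd_Cauchy_Schwarz[OF A psd x y] by (simp add: Ay power2_eq_square)
    also have "\<dots> \<le> (x \<bullet> (A *\<^sub>v x)) * ((c + 1) * (x \<bullet> x))"
    proof (rule mult_left_mono[OF _ psd[OF x]])
      have "y \<bullet> x \<le> c * (x \<bullet> x)"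
        using c(2)[OF x] comm_scalar_prod[OF y x] by (simp add: y_def)
      also have "\<dots> \<le> (c + 1) * (x \<bullet> x)" using pos by simp
      finally show "y \<bullet> x \<le> (c + 1) * (x \<bullet> x)" .
    qed
    finally have "x \<bullet> x \<le> (x \<bullet> (A *\<^sub>v x)) * (c + 1)" using pos by simp
    with c(1) show ?thesis by (simp add: field_simps)
  qed
  with c(1) show ?thesis by (intro that[of "1 / (c + 1)"]) auto
qed

text \<open>The least eigenvalue is the supremum \<open>s\<close> of all \<open>t\<close> for which \<open>A - t I\<close> is positive
  semidefinite: if \<open>A - s I\<close> were invertible it would be coercive, and \<open>s\<close> could be increased.\<close>

lemma symmetric_least_eigenvalue:
  fixes A :: "real mat"
  assumes A: "A \<in> carrier_mat d d" "transpose_mat A = A" and d: "0 < d"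
  obtains t where "t \<in> spectrum A"
    "\<And>x. x \<in> carrier_vec d \<Longrightarrow> t * (x \<bullet> x) \<le> x \<bullet> (A *\<^sub>v x)"
proof -
  define T where "T = {t. \<forall>x \<in> carrier_vec d. t * (x \<bullet> x) \<le> x \<bullet> (A *\<^sub>v x)}"
  obtain c where c: "\<And>x. x \<in> carrier_vec d \<Longrightarrow> \<bar>x \<bullet> (A *\<^sub>v x)\<bar> \<le> c * (x \<bullet> x)"
    using quadratic_form_bounded[OF A(1)] by metis
  have "- c \<in> T" using c by (fastforce simp: T_def abs_le_iff)
  then have ne: "T \<noteq> {}" by blast
  \<comment> \<open>Testing at a vector of length 1 bounds \<open>T\<close> by a diagonal entry;
    such a vector exists because \<open>0 < d\<close>.\<close>
  have "t \<le> unit_vec d 0 \<bullet> (A *\<^sub>v unit_vec d 0)" if "t \<in> T" for t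
    using that d by (auto simp: T_def dest!: bspec[of _ _ "unit_vec d 0"])
  then have bdd: "bdd_above T" by (rule bdd_aboveI)
  define s where "s = Sup T"
  \<comment> \<open>The supremum itself lies in \<open>T\<close>, because every Rayleigh quotient is
    an upper bound of \<open>T\<close>.\<close>
  have sT: "s * (x \<bullet> x) \<le> x \<bullet> (A *\<^sub>v x)" if x: "x \<in> carrier_vec d" for x
  proof (cases "x \<bullet> x = 0")
    case True
    from scalar_prod_self_eq_0[OF x True] A(1) show ?thesis by simp
  next
    case False
    then have pos: "0 < x \<bullet> x" using scalar_prod_self_nonneg[of x] by simp
    have "s \<le> (x \<bullet> (A *\<^sub>v x)) / (x \<bullet> x)"
      unfolding s_def using ne
      by (rule cSup_least) (use x pos in \<open>simp add: T_def field_simps\<close>)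
    with pos show ?thesis by (simp add: field_simps)
  qed
  define C where "C = A + (- s) \<cdot>\<^sub>m 1\<^sub>m d"
  have C: "C \<in> carrier_mat d d" using A by (simp add: C_def)
  have Csym: "transpose_mat C = C"
  proof
    fix i j assume ij: "i < dim_row C" "j < dim_col C"
    have "A $$ (j, i) = A $$ (i, j)"
      using arg_cong[OF A(2), of "\<lambda>m. m $$ (i, j)"] A(1) C ij by simp
    then show "transpose_mat C $$ (i, j) = C $$ (i, j)"
      using A(1) C ij by (simp add: C_def)
  qed (use C in auto)
  have Cx: "C *\<^sub>v x = A *\<^sub>v x + (- s) \<cdot>\<^sub>v x" if "x \<in> carrier_vec d" for x
  proof -
    have "(- s) \<cdot>\<^sub>m 1\<^sub>m d *\<^sub>v x = (- s) \<cdot>\<^sub>v x"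
      using that by (intro eq_vecI) (simp_all add: row_smult)
    then show ?thesis
      using A(1) that by (simp add: C_def add_mult_distrib_mat_vec[of _ d d])
  qed
  have Cq: "x \<bullet> (C *\<^sub>v x) = x \<bullet> (A *\<^sub>v x) - s * (x \<bullet> x)" if x: "x \<in> carrier_vec d" for x
    using A(1) x by (simp add: Cx scalar_prod_add_distrib[of _ d])
  have "det C = 0"
  proof (rule ccontr)
    assume "det C \<noteq> 0"
    moreover have "\<And>x. x \<in> carrier_vec d \<Longrightarrow> 0 \<le> x \<bullet> (C *\<^sub>v x)"
      using sT by (simp add: Cq)
    ultimately obtain e where "0 < e" "\<And>x. x \<in> carrier_vec d \<Longrightarrow> e * (x \<bullet> x) \<le> x \<bullet> (C *\<^sub>v x)"
      using psd_invertible_coercive[OF C Csym] by metis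
    then have "s + e \<in> T" by (simp add: T_def Cq algebra_simps)
    then have "s + e \<le> s" unfolding s_def using bdd by (rule cSup_upper)
    with \<open>0 < e\<close> show False by simp
  qed
  then obtain v where v: "v \<in> carrier_vec d" "v \<noteq> 0\<^sub>v d" "C *\<^sub>v v = 0\<^sub>v d"
    using det_0_iff_vec_prod_zero[OF C] by blast
  have "A *\<^sub>v v = s \<cdot>\<^sub>v v"
  proof
    fix i assume "i < dim_vec (s \<cdot>\<^sub>v v)"
    then have i: "i < d" using v(1) by simp
    have "(A *\<^sub>v v + (- s) \<cdot>\<^sub>v v) $ i = (0\<^sub>v d :: real vec) $ i"
      using v Cx by metis
    with i A(1) v(1) show "(A *\<^sub>v v) $ i = (s \<cdot>\<^sub>v v) $ i" by simp
  qed (use A v in simp)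
  with v A(1) have "s \<in> spectrum A"
    by (auto simp: spectrum_def eigenvalue_def eigenvector_def)
  then show ?thesis using sT by (rule that)
qed

text \<open>The Rayleigh bound. It suffices that some eigenvalue bounds the form from below, since
  \<open>lambda_min A\<close> is the minimum of a finite spectrum and cannot exceed it.\<close>

lemma lambda_min_le_quadratic_form:
  fixes A :: "real mat"
  assumes A: "A \<in> carrier_mat d d" "transpose_mat A = A" and d: "0 < d"
    and x: "x \<in> carrier_vec d"
  shows "lambda_min A * (x \<bullet> x) \<le> x \<bullet> (A *\<^sub>v x)"
proof -
  obtain t where t: "t \<in> spectrum A"
    "\<And>x. x \<in> carrier_vec d \<Longrightarrow> t * (x \<bullet> x) \<le> x \<bullet> (A *\<^sub>v x)"
    using symmetric_least_eigenvalue[OF A d] by metis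
  have "lambda_min A \<le> t"
    unfolding lambda_min_def using card_finite_spectrum(1)[OF A(1)] t(1) by (rule Min_le)
  then have "lambda_min A * (x \<bullet> x) \<le> t * (x \<bullet> x)"
    using scalar_prod_self_nonneg by (rule mult_right_mono)
  with t(2)[OF x] show ?thesis by simp
qed

section \<open>Definiteness, invertibility and symmetry\<close>

lemma pos_def_mat_det:
  assumes "pos_def_mat d A"
  shows "det A \<noteq> 0"
proof
  assume "det A = 0"
  with assms obtain v where "v \<in> carrier_vec d" "v \<noteq> 0\<^sub>v d" "A *\<^sub>v v = 0\<^sub>v d"
    using det_0_iff_vec_prod_zero_field[of A d] by (auto simp: pos_def_mat_def)
  with assms have "0 < v \<bullet> 0\<^sub>v d" unfolding pos_def_mat_def by metis
  with \<open>v \<in> carrier_vec d\<close> show False by simp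
qed

lemma pos_def_mat_psd:
  assumes "pos_def_mat d A" "x \<in> carrier_vec d"
  shows "0 \<le> x \<bullet> (A *\<^sub>v x)"
  using assms by (cases "x = 0\<^sub>v d") (auto simp: pos_def_mat_def less_imp_le)

lemma invertible_mat_det:
  fixes A :: "real mat"
  assumes A: "A \<in> carrier_mat d d" and "invertible_mat A"
  shows "det A \<noteq> 0"
proof -
  obtain C where C: "A * C = 1\<^sub>m (dim_row A)" "C * A = 1\<^sub>m (dim_row C)"
    using assms by (auto simp: invertible_mat_def inverts_mat_def)
  \<comment> \<open>Invertibility does not state the dimensions of \<open>C\<close>; comparing
    column counts in the two identities recovers them.\<close>
  have "C \<in> carrier_mat d d"
    using arg_cong[OF C(1), of dim_col] arg_cong[OF C(2), of dim_col] A by auto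
  from det_mult[OF A this] have "det A * det C = 1" using C(1) A by simp
  then show ?thesis by auto
qed

text \<open>The transposed inverse is also a right inverse of \<open>A\<close>, and inverses are
  unique.\<close>

lemma transpose_mat_inv:
  assumes A: "A \<in> carrier_mat d d" "transpose_mat A = A" and det: "det A \<noteq> 0"
  shows "transpose_mat (mat_inv A) = mat_inv A"
proof -
  note inv = mat_inv_inverts[OF A(1) det]
  have "A * transpose_mat (mat_inv A) = 1\<^sub>m d"
    using transpose_mult[OF inv(3) A(1)] by (simp add: A(2) inv(2))
  then have "mat_inv A * (A * transpose_mat (mat_inv A)) = mat_inv A"
    using inv(3) by simp
  moreover have "mat_inv A * (A * transpose_mat (mat_inv A)) = transpose_mat (mat_inv A)"
    using inv A(1) assoc_mult_mat[OF inv(3) A(1), of "transpose_mat (mat_inv A)" d] by simp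
  ultimately show ?thesis by simp
qed

subsection \<open>Covariances of linear combinations\<close>

text \<open>The scalar counterpart of the condition that \<open>random_vec\<close> puts on
  components. It is stable under linear combinations and makes products integrable, which is what
  bilinearity of the covariance requires.\<close>

definition square_integrable :: "'a measure \<Rightarrow> ('a \<Rightarrow> real) \<Rightarrow> bool" where
  "square_integrable M X \<longleftrightarrow> X \<in> borel_measurable M \<and> integrable M (\<lambda>\<omega>. (X \<omega>)\<^sup>2)"

lemma square_integrable_product:
  assumes "square_integrable M X" "square_integrable M Y"
  shows "integrable M (\<lambda>\<omega>. X \<omega> * Y \<omega>)"
proof (rule Bochner_Integration.integrable_bound)
  show "integrable M (\<lambda>\<omega>. (X \<omega>)\<^sup>2 + (Y \<omega>)\<^sup>2)"
    using assms by (auto simp: square_integrable_def)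
  show "(\<lambda>\<omega>. X \<omega> * Y \<omega>) \<in> borel_measurable M"
    using assms by (auto simp: square_integrable_def)
  show "AE \<omega> in M. norm (X \<omega> * Y \<omega>) \<le> norm ((X \<omega>)\<^sup>2 + (Y \<omega>)\<^sup>2)"
  proof (rule AE_I2)
    fix \<omega>
    have "2 * (\<bar>X \<omega>\<bar> * \<bar>Y \<omega>\<bar>) \<le> (X \<omega>)\<^sup>2 + (Y \<omega>)\<^sup>2"
      using sum_squares_bound[of "\<bar>X \<omega>\<bar>" "\<bar>Y \<omega>\<bar>"] by simp
    moreover have "0 \<le> \<bar>X \<omega>\<bar> * \<bar>Y \<omega>\<bar>" by simp
    ultimately have "\<bar>X \<omega>\<bar> * \<bar>Y \<omega>\<bar> \<le> (X \<omega>)\<^sup>2 + (Y \<omega>)\<^sup>2" by linarith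
    then show "norm (X \<omega> * Y \<omega>) \<le> norm ((X \<omega>)\<^sup>2 + (Y \<omega>)\<^sup>2)"
      by (simp add: abs_mult)
  qed
qed

lemma square_integrable_add:
  assumes "square_integrable M X" "square_integrable M Y"
  shows "square_integrable M (\<lambda>\<omega>. X \<omega> + Y \<omega>)"
  using assms square_integrable_product[OF assms]
  by (auto simp: square_integrable_def power2_sum mult.assoc)

lemma square_integrable_scale:
  assumes "square_integrable M X"
  shows "square_integrable M (\<lambda>\<omega>. c * X \<omega>)"
  using assms by (auto simp: square_integrable_def power_mult_distrib)

lemma (in finite_measure) square_integrable_const: "square_integrable M (\<lambda>\<omega>. c)"
  by (simp add: square_integrable_def)

lemma square_integrable_sum:
  assumes "\<And>i. i \<in> I \<Longrightarrow> square_integrable M (X i)"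
  shows "square_integrable M (\<lambda>\<omega>. \<Sum>i\<in>I. X i \<omega>)"
  using assms
proof (induction I rule: infinite_finite_induct)
  case (insert i I)
  then show ?case by (auto intro: square_integrable_add)
qed (auto simp: square_integrable_def)

text \<open>A product with the constant 1, itself square integrable because the measure is
  finite.\<close>

lemma (in finite_measure) square_integrable_integrable:
  assumes "square_integrable M X"
  shows "integrable M X"
  using square_integrable_product[OF assms square_integrable_const[of 1]] by simp

text \<open>Random vectors have a guaranteed dimension only on \<open>space M\<close>, so scalar
  products can be rewritten as finite sums only there.\<close>

lemma square_integrable_cong:
  assumes "\<And>\<omega>. \<omega> \<in> space M \<Longrightarrow> X \<omega> = Y \<omega>"
  shows "square_integrable M X = square_integrable M Y"
proof -
  have "X \<in> borel_measurable M \<longleftrightarrow> Y \<in> borel_measurable M"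
    using assms by (rule measurable_cong)
  moreover have "integrable M (\<lambda>\<omega>. (X \<omega>)\<^sup>2) \<longleftrightarrow> integrable M (\<lambda>\<omega>. (Y \<omega>)\<^sup>2)"
    using assms by (intro Bochner_Integration.integrable_cong) auto
  ultimately show ?thesis by (simp add: square_integrable_def)
qed

section \<open>Bilinearity of the covariance and moments of scalar products\<close>

context prob_space
begin

lemma covariance_cong:
  assumes "\<And>\<omega>. \<omega> \<in> space M \<Longrightarrow> X \<omega> = X' \<omega>" "\<And>\<omega>. \<omega> \<in> space M \<Longrightarrow> Y \<omega> = Y' \<omega>"
  shows "covariance M X Y = covariance M X' Y'"
proof -
  have "expectation X = expectation X'" "expectation Y = expectation Y'"
    using assms by (auto intro: Bochner_Integration.integral_cong)
  with assms show ?thesis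
    unfolding covariance_def by (auto intro: Bochner_Integration.integral_cong)
qed

lemma covariance_commute: "covariance M X Y = covariance M Y X"
  by (simp add: covariance_def mult.commute)

lemma covariance_eq:
  assumes "square_integrable M X" "square_integrable M Y"
  shows "covariance M X Y = expectation (\<lambda>\<omega>. X \<omega> * Y \<omega>) - expectation X * expectation Y"
proof -
  define a b where "a = expectation X" "b = expectation Y"
  have "covariance M X Y = expectation (\<lambda>\<omega>. X \<omega> * Y \<omega> - b * X \<omega> - a * Y \<omega> + a * b)"
    by (simp add: covariance_def a_b_def algebra_simps)
  also have "\<dots> = expectation (\<lambda>\<omega>. X \<omega> * Y \<omega>) - b * a - a * b + a * b"
    using square_integrable_product[OF assms] assms[THEN square_integrable_integrable]
    by (simp add: prob_space a_b_def)
  finally show ?thesis by (simp add: a_b_def)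
qed

lemma covariance_add_left:
  assumes "square_integrable M X" "square_integrable M Y" "square_integrable M Z"
  shows "covariance M (\<lambda>\<omega>. X \<omega> + Y \<omega>) Z = covariance M X Z + covariance M Y Z"
  using assms square_integrable_product[OF assms(1,3)] square_integrable_product[OF assms(2,3)]
  by (simp add: covariance_eq square_integrable_add square_integrable_integrable distrib_right)

text \<open>The Bochner integral commutes with scaling even when the function is not integrable, as
  both sides are then 0.\<close>

lemma covariance_scale_left: "covariance M (\<lambda>\<omega>. c * X \<omega>) Y = c * covariance M X Y"
  by (simp add: covariance_def mult.assoc flip: right_diff_distrib)

lemma covariance_const_left: "covariance M (\<lambda>\<omega>. c) Y = 0"
  by (simp add: covariance_def prob_space)

lemma covariance_sum_left:
  assumes "finite I" "\<And>i. i \<in> I \<Longrightarrow> square_integrable M (X i)" "square_integrable M Y"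
  shows "covariance M (\<lambda>\<omega>. \<Sum>i\<in>I. c i * X i \<omega>) Y = (\<Sum>i\<in>I. c i * covariance M (X i) Y)"
  using assms(1,2)
proof (induction I)
  case empty
  show ?case by (simp add: covariance_const_left)
next
  case (insert i I)
  then show ?case
    using assms(3)
    by (simp add: covariance_add_left covariance_scale_left square_integrable_scale square_integrable_sum)
qed

lemma scalar_prod_random_vec:
  assumes "random_vec M d X" "\<omega> \<in> space M"
  shows "a \<bullet> X \<omega> = (\<Sum>i\<in>{0..<d}. a $ i * X \<omega> $ i)"
  using assms by (auto simp: random_vec_def scalar_prod_def)

lemma random_vec_component:
  assumes "random_vec M d X" "i < d"
  shows "square_integrable M (\<lambda>\<omega>. X \<omega> $ i)"
  using assms by (simp add: random_vec_def square_integrable_def)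

lemma square_integrable_scalar_prod:
  assumes "random_vec M d X"
  shows "square_integrable M (\<lambda>\<omega>. a \<bullet> X \<omega>)"
proof -
  have "square_integrable M (\<lambda>\<omega>. \<Sum>i\<in>{0..<d}. a $ i * X \<omega> $ i)"
    using random_vec_component[OF assms] by (intro square_integrable_sum square_integrable_scale) auto
  then show ?thesis
    by (subst square_integrable_cong[OF scalar_prod_random_vec[OF assms]])
qed

lemma expectation_scalar_prod:
  assumes "random_vec M d X"
  shows "expectation (\<lambda>\<omega>. a \<bullet> X \<omega>) = a \<bullet> mean_vec M d X"
proof -
  have "expectation (\<lambda>\<omega>. a \<bullet> X \<omega>) = expectation (\<lambda>\<omega>. \<Sum>i\<in>{0..<d}. a $ i * X \<omega> $ i)"
    using scalar_prod_random_vec[OF assms] by (intro Bochner_Integration.integral_cong) auto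
  also have "\<dots> = (\<Sum>i\<in>{0..<d}. expectation (\<lambda>\<omega>. a $ i * X \<omega> $ i))"
    using random_vec_component[OF assms]
    by (intro Bochner_Integration.integral_sum integrable_mult_right square_integrable_integrable) auto
  also have "\<dots> = a \<bullet> mean_vec M d X"
    by (simp add: scalar_prod_def mean_vec_def)
  finally show ?thesis .
qed

lemma covariance_scalar_prod_left:
  assumes "random_vec M d X" "square_integrable M Y"
  shows "covariance M (\<lambda>\<omega>. a \<bullet> X \<omega>) Y
    = (\<Sum>i\<in>{0..<d}. a $ i * covariance M (\<lambda>\<omega>. X \<omega> $ i) Y)"
proof -
  have "covariance M (\<lambda>\<omega>. a \<bullet> X \<omega>) Y = covariance M (\<lambda>\<omega>. \<Sum>i\<in>{0..<d}. a $ i * X \<omega> $ i) Y"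
    using scalar_prod_random_vec[OF assms(1)] by (intro covariance_cong) auto
  also have "\<dots> = (\<Sum>i\<in>{0..<d}. a $ i * covariance M (\<lambda>\<omega>. X \<omega> $ i) Y)"
    using random_vec_component[OF assms(1)] assms(2) by (intro covariance_sum_left) auto
  finally show ?thesis .
qed

text \<open>Left linearity is applied twice, the second time through
  \<open>covariance_commute\<close>. Allowing two different vectors serves both the covariance
  matrix of one vector and the vanishing cross terms.\<close>

lemma covariance_scalar_prods:
  assumes X: "random_vec M d X" and Y: "random_vec M e Y"
  shows "covariance M (\<lambda>\<omega>. a \<bullet> X \<omega>) (\<lambda>\<omega>. b \<bullet> Y \<omega>)
    = (\<Sum>i\<in>{0..<d}. \<Sum>j\<in>{0..<e}. a $ i * b $ j * covariance M (\<lambda>\<omega>. X \<omega> $ i) (\<lambda>\<omega>. Y \<omega> $ j))"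
proof -
  have "covariance M (\<lambda>\<omega>. X \<omega> $ i) (\<lambda>\<omega>. b \<bullet> Y \<omega>)
    = (\<Sum>j\<in>{0..<e}. b $ j * covariance M (\<lambda>\<omega>. X \<omega> $ i) (\<lambda>\<omega>. Y \<omega> $ j))" if "i < d" for i
    using covariance_scalar_prod_left[OF Y random_vec_component[OF X that], of b]
    by (simp add: covariance_commute)
  then show ?thesis
    by (simp add: covariance_scalar_prod_left[OF X square_integrable_scalar_prod[OF Y]]
        sum_distrib_left mult.assoc)
qed

lemma covariance_scalar_prods_cov_mat:
  assumes X: "random_vec M d X" and b: "b \<in> carrier_vec d"
  shows "covariance M (\<lambda>\<omega>. a \<bullet> X \<omega>) (\<lambda>\<omega>. b \<bullet> X \<omega>) = a \<bullet> (cov_mat M d X *\<^sub>v b)"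
  using b unfolding covariance_scalar_prods[OF X X]
  by (auto simp: scalar_prod_def cov_mat_def sum_distrib_left mult_ac intro!: sum.cong)

lemma covariance_scalar_prods_uncorrelated:
  assumes "random_vec M d X" "random_vec M e Y" "uncorrelated M d X e Y"
  shows "covariance M (\<lambda>\<omega>. a \<bullet> X \<omega>) (\<lambda>\<omega>. b \<bullet> Y \<omega>) = 0"
  using assms(3) unfolding covariance_scalar_prods[OF assms(1,2)] uncorrelated_def
  by (intro sum.neutral ballI) simp

lemma squared_sharpe_covariance: "squared_sharpe M X = (expectation X)\<^sup>2 / covariance M X X"
  by (simp add: squared_sharpe_def covariance_def power2_eq_square)

end

subsection \<open>The factor model\<close>

context factor_model
begin

lemma mean_carrier: "\<mu> \<in> carrier_vec K"
  using f_mean by (auto simp: mean_vec_def)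

lemma Sf_carrier: "Sf \<in> carrier_mat K K" "transpose_mat Sf = Sf"
  and Vu_carrier: "Vu \<in> carrier_mat n n" "transpose_mat Vu = Vu"
  using Sf_pos_def Vu_pos_def by (auto simp: pos_def_mat_def)

lemmas Sf_det = pos_def_mat_det[OF Sf_pos_def]
  and Vu_det = pos_def_mat_det[OF Vu_pos_def]

lemmas Vu_inv = mat_inv_inverts[OF Vu_carrier(1) Vu_det]

lemma info_carrier: "info_mat B Vu \<in> carrier_mat K K"
  using B_carrier Vu_inv(3) by (simp add: info_mat_def)

lemma info_symmetric: "transpose_mat (info_mat B Vu) = info_mat B Vu"
proof -
  have "transpose_mat (info_mat B Vu) = transpose_mat B * (transpose_mat (mat_inv Vu) * B)"
    using transpose_mult[of "transpose_mat B * mat_inv Vu" K n B K]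
      transpose_mult[of "transpose_mat B" K n "mat_inv Vu" n] B_carrier Vu_inv(3)
    by (simp add: info_mat_def)
  then show ?thesis
    using transpose_mat_inv[OF Vu_carrier Vu_det] B_carrier Vu_inv(3)
    by (simp add: info_mat_def)
qed

lemmas info_det = invertible_mat_det[OF info_carrier info_invertible]

lemma info_mult_vec:
  assumes "x \<in> carrier_vec K"
  shows "info_mat B Vu *\<^sub>v x = transpose_mat B *\<^sub>v (mat_inv Vu *\<^sub>v (B *\<^sub>v x))"
  using assms B_carrier Vu_inv(3)
  by (simp add: info_mat_def assoc_mult_mat_vec[of _ K n _ K] assoc_mult_mat_vec[of _ K n _ n])

section \<open>Moments of portfolio returns\<close>

lemma f_carrier: "\<omega> \<in> space M \<Longrightarrow> f \<omega> \<in> carrier_vec K"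
  and u_carrier: "\<omega> \<in> space M \<Longrightarrow> u \<omega> \<in> carrier_vec n"
  using f_random u_random by (auto simp: random_vec_def)

text \<open>Moving \<open>B\<close> onto the weights exhibits \<open>B' a\<close> as the factor
  exposure of the portfolio \<open>a\<close>. The locale leaves the dimension of
  \<open>\<phi>\<close> open, hence the explicit assumption here and below.\<close>

lemma scalar_prod_returns:
  assumes \<phi>: "\<phi> \<in> carrier_vec K" and a: "a \<in> carrier_vec n" and \<omega>: "\<omega> \<in> space M"
  shows "a \<bullet> r \<omega> = a \<bullet> (B *\<^sub>v \<phi>) + ((transpose_mat B *\<^sub>v a) \<bullet> f \<omega> + a \<bullet> u \<omega>)"
  using B_carrier f_carrier[OF \<omega>] u_carrier[OF \<omega>] a \<phi>
  by (simp add: returns[OF \<omega>] scalar_prod_add_distrib[of _ n]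
      transpose_vec_mult_scalar[of _ n K])

lemma expectation_returns:
  assumes \<phi>: "\<phi> \<in> carrier_vec K" and a: "a \<in> carrier_vec n"
  shows "expectation (\<lambda>\<omega>. a \<bullet> r \<omega>) = a \<bullet> (B *\<^sub>v (\<mu> + \<phi>))"
proof -
  let ?p = "transpose_mat B *\<^sub>v a"
  have "expectation (\<lambda>\<omega>. a \<bullet> r \<omega>)
      = expectation (\<lambda>\<omega>. a \<bullet> (B *\<^sub>v \<phi>) + (?p \<bullet> f \<omega> + a \<bullet> u \<omega>))"
    using scalar_prod_returns[OF \<phi> a] by (intro Bochner_Integration.integral_cong) auto
  also have "\<dots> = a \<bullet> (B *\<^sub>v \<phi>) + (?p \<bullet> \<mu> + a \<bullet> 0\<^sub>v n)"
    using square_integrable_integrable[OF square_integrable_scalar_prod[OF f_random, of ?p]]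
      square_integrable_integrable[OF square_integrable_scalar_prod[OF u_random, of a]]
    by (simp add: expectation_scalar_prod[OF f_random] expectation_scalar_prod[OF u_random]
        f_mean u_mean prob_space)
  also have "\<dots> = a \<bullet> (B *\<^sub>v (\<mu> + \<phi>))"
    using B_carrier a \<phi> mean_carrier
    by (simp add: transpose_vec_mult_scalar[of _ n K] mult_add_distrib_mat_vec[of _ n K]
        scalar_prod_add_distrib[of _ n])
  finally show ?thesis .
qed

text \<open>At this point only a matrix formula; \<open>cov_returns\<close> identifies it with the
  covariance matrix of the returns.\<close>

definition VR :: "real mat" where
  "VR = B * Sf * transpose_mat B + Vu"

lemma VR_carrier: "VR \<in> carrier_mat n n"
  using B_carrier Sf_carrier Vu_carrier by (simp add: VR_def)

text \<open>Splits portfolio risk into a factor part and a residual part. Dropping the residual part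
  yields the Sharpe bound, and its strict positivity makes \<open>VR\<close> invertible.\<close>

lemma VR_form:
  assumes a: "a \<in> carrier_vec n" and b: "b \<in> carrier_vec n"
  shows "a \<bullet> (VR *\<^sub>v b)
    = (transpose_mat B *\<^sub>v a) \<bullet> (Sf *\<^sub>v (transpose_mat B *\<^sub>v b)) + a \<bullet> (Vu *\<^sub>v b)"
proof -
  have "VR *\<^sub>v b = B *\<^sub>v (Sf *\<^sub>v (transpose_mat B *\<^sub>v b)) + Vu *\<^sub>v b"
    using B_carrier Sf_carrier Vu_carrier b
    by (simp add: VR_def add_mult_distrib_mat_vec[of _ n n] assoc_mult_mat_vec[of _ n K _ n]
        assoc_mult_mat_vec[of _ n K _ K] assoc_mult_mat_vec[of _ K K _ n])
  then show ?thesis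
    using B_carrier Sf_carrier Vu_carrier a b
    by (simp add: scalar_prod_add_distrib[of _ n] transpose_vec_mult_scalar[of _ n K])
qed

text \<open>Constants drop out, uncorrelatedness removes the two mixed terms, and the remaining two
  are the summands of \<open>VR_form\<close>.\<close>

lemma covariance_returns:
  assumes \<phi>: "\<phi> \<in> carrier_vec K" and a: "a \<in> carrier_vec n" and b: "b \<in> carrier_vec n"
  shows "covariance M (\<lambda>\<omega>. a \<bullet> r \<omega>) (\<lambda>\<omega>. b \<bullet> r \<omega>) = a \<bullet> (VR *\<^sub>v b)"
proof -
  let ?p = "\<lambda>a. transpose_mat B *\<^sub>v a"
  have sqf: "square_integrable M (\<lambda>\<omega>. p \<bullet> f \<omega>)" and squ: "square_integrable M (\<lambda>\<omega>. q \<bullet> u \<omega>)" for p q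
    using square_integrable_scalar_prod f_random u_random by auto
  have left: "covariance M (\<lambda>\<omega>. c + (p \<bullet> f \<omega> + q \<bullet> u \<omega>)) Z
      = covariance M (\<lambda>\<omega>. p \<bullet> f \<omega>) Z + covariance M (\<lambda>\<omega>. q \<bullet> u \<omega>) Z"
    if "square_integrable M Z" for c p q Z
    using that by (simp add: covariance_add_left square_integrable_add sqf squ
        square_integrable_const covariance_const_left)
  have right: "covariance M Z (\<lambda>\<omega>. c + (p \<bullet> f \<omega> + q \<bullet> u \<omega>))
      = covariance M Z (\<lambda>\<omega>. p \<bullet> f \<omega>) + covariance M Z (\<lambda>\<omega>. q \<bullet> u \<omega>)"
    if "square_integrable M Z" for c p q Z
    using left[OF that] by (simp add: covariance_commute)
  have fu: "covariance M (\<lambda>\<omega>. p \<bullet> f \<omega>) (\<lambda>\<omega>. q \<bullet> u \<omega>) = 0"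
    and uf: "covariance M (\<lambda>\<omega>. q \<bullet> u \<omega>) (\<lambda>\<omega>. p \<bullet> f \<omega>) = 0" for p q
    using covariance_scalar_prods_uncorrelated[OF f_random u_random f_u_uncorrelated]
    by (simp_all add: covariance_commute)
  have "covariance M (\<lambda>\<omega>. a \<bullet> r \<omega>) (\<lambda>\<omega>. b \<bullet> r \<omega>)
    = covariance M (\<lambda>\<omega>. a \<bullet> (B *\<^sub>v \<phi>) + (?p a \<bullet> f \<omega> + a \<bullet> u \<omega>))
       (\<lambda>\<omega>. b \<bullet> (B *\<^sub>v \<phi>) + (?p b \<bullet> f \<omega> + b \<bullet> u \<omega>))"
    using scalar_prod_returns[OF \<phi>] a b by (intro covariance_cong) auto
  also have "\<dots> = covariance M (\<lambda>\<omega>. ?p a \<bullet> f \<omega>) (\<lambda>\<omega>. ?p b \<bullet> f \<omega>)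
      + covariance M (\<lambda>\<omega>. a \<bullet> u \<omega>) (\<lambda>\<omega>. b \<bullet> u \<omega>)"
    by (simp add: left right sqf squ fu uf square_integrable_add square_integrable_const)
  also have "\<dots> = a \<bullet> (VR *\<^sub>v b)"
    using a b B_carrier
    by (simp add: VR_form covariance_scalar_prods_cov_mat[OF f_random]
        covariance_scalar_prods_cov_mat[OF u_random] f_cov u_cov)
  finally show ?thesis .
qed

lemma returns_carrier: "\<phi> \<in> carrier_vec K \<Longrightarrow> \<omega> \<in> space M \<Longrightarrow> r \<omega> \<in> carrier_vec n"
  using B_carrier f_carrier u_carrier returns by simp

text \<open>A single asset is the portfolio with unit weights, so the mean vector and covariance
  matrix follow entrywise from the portfolio formulas.\<close>

lemma returns_component:
  assumes "\<phi> \<in> carrier_vec K" "i < n" "\<omega> \<in> space M"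
  shows "r \<omega> $ i = unit_vec n i \<bullet> r \<omega>"
  using assms returns_carrier by simp

lemma mean_returns:
  assumes \<phi>: "\<phi> \<in> carrier_vec K"
  shows "mean_vec M n r = B *\<^sub>v (\<mu> + \<phi>)"
proof
  fix i assume "i < dim_vec (B *\<^sub>v (\<mu> + \<phi>))"
  with B_carrier have i: "i < n" by simp
  have "expectation (\<lambda>\<omega>. r \<omega> $ i) = expectation (\<lambda>\<omega>. unit_vec n i \<bullet> r \<omega>)"
    using returns_component[OF \<phi> i] by (intro Bochner_Integration.integral_cong) auto
  also have "\<dots> = unit_vec n i \<bullet> (B *\<^sub>v (\<mu> + \<phi>))"
    by (simp add: expectation_returns[OF \<phi>])
  also have "\<dots> = (B *\<^sub>v (\<mu> + \<phi>)) $ i"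
    using B_carrier mean_carrier \<phi> i by (intro scalar_prod_left_unit) auto
  finally show "mean_vec M n r $ i = (B *\<^sub>v (\<mu> + \<phi>)) $ i"
    using i by (simp add: mean_vec_def)
qed (use B_carrier in \<open>simp add: mean_vec_def\<close>)

lemma cov_returns:
  assumes \<phi>: "\<phi> \<in> carrier_vec K"
  shows "cov_mat M n r = VR"
proof
  fix i j assume "i < dim_row VR" "j < dim_col VR"
  with VR_carrier have ij: "i < n" "j < n" by auto
  have "covariance M (\<lambda>\<omega>. r \<omega> $ i) (\<lambda>\<omega>. r \<omega> $ j)
      = covariance M (\<lambda>\<omega>. unit_vec n i \<bullet> r \<omega>) (\<lambda>\<omega>. unit_vec n j \<bullet> r \<omega>)"
    using returns_component[OF \<phi>] ij by (intro covariance_cong) auto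
  also have "\<dots> = unit_vec n i \<bullet> (VR *\<^sub>v unit_vec n j)"
    by (simp add: covariance_returns[OF \<phi>])
  also have "\<dots> = VR $$ (i, j)"
    using VR_carrier ij by (simp add: scalar_prod_left_unit[of _ n])
  finally show "cov_mat M n r $$ (i, j) = VR $$ (i, j)"
    using ij by (simp add: cov_mat_def)
qed (use VR_carrier in \<open>simp_all add: cov_mat_def\<close>)

section \<open>The mean-variance portfolio\<close>

lemma VR_form_ge:
  assumes "w \<in> carrier_vec n"
  shows "(transpose_mat B *\<^sub>v w) \<bullet> (Sf *\<^sub>v (transpose_mat B *\<^sub>v w)) \<le> w \<bullet> (VR *\<^sub>v w)"
  using VR_form[OF assms assms] pos_def_mat_psd[OF Vu_pos_def assms] by simp

lemma VR_det: "det VR \<noteq> 0"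
proof
  assume "det VR = 0"
  then obtain v where v: "v \<in> carrier_vec n" "v \<noteq> 0\<^sub>v n" "VR *\<^sub>v v = 0\<^sub>v n"
    using det_0_iff_vec_prod_zero_field[OF VR_carrier] by blast
  have "0 \<le> (transpose_mat B *\<^sub>v v) \<bullet> (Sf *\<^sub>v (transpose_mat B *\<^sub>v v))"
    using B_carrier v(1) by (intro pos_def_mat_psd[OF Sf_pos_def]) simp
  moreover have "0 < v \<bullet> (Vu *\<^sub>v v)" using Vu_pos_def v by (simp add: pos_def_mat_def)
  ultimately have "0 < v \<bullet> (VR *\<^sub>v v)" by (simp add: VR_form[OF v(1) v(1)])
  with v show False by simp
qed

lemmas VR_inv = mat_inv_inverts[OF VR_carrier VR_det]

lemma squared_sharpe_mv:
  assumes \<phi>: "\<phi> \<in> carrier_vec K"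
  defines "m \<equiv> B *\<^sub>v (\<mu> + \<phi>)"
  shows "squared_sharpe M (mv_return M n r) = m \<bullet> (mat_inv VR *\<^sub>v m)"
    and "0 \<le> m \<bullet> (mat_inv VR *\<^sub>v m)"
    and "m \<bullet> (mat_inv VR *\<^sub>v m) \<le> (\<mu> + \<phi>) \<bullet> (mat_inv Sf *\<^sub>v (\<mu> + \<phi>))"
proof -
  have lam: "\<mu> + \<phi> \<in> carrier_vec K" using \<phi> mean_carrier by simp
  then have m: "m \<in> carrier_vec n" using B_carrier by (simp add: m_def)
  define w where "w = mat_inv VR *\<^sub>v m"
  have w: "w \<in> carrier_vec n" using VR_inv(3) m by (simp add: w_def)
  have VRw: "VR *\<^sub>v w = m" using mat_inv_mult_vec[OF VR_carrier VR_det m] by (simp add: w_def)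
  have VR_sym: "transpose_mat VR = VR"
  proof -
    have "transpose_mat (B * Sf * transpose_mat B) = B * Sf * transpose_mat B"
      using transpose_mult[of "B * Sf" n K "transpose_mat B" n] transpose_mult[of B n K Sf K]
        B_carrier Sf_carrier by simp
    then show ?thesis
      using transpose_add[of "B * Sf * transpose_mat B" n n Vu] B_carrier Sf_carrier Vu_carrier
      by (simp add: VR_def)
  qed
  have s: "w \<bullet> m = m \<bullet> w" using w m by (rule comm_scalar_prod)
  \<comment> \<open>By symmetry the inverse moves from the returns to the mean, giving a portfolio
    with the constant weights \<open>w\<close>.\<close>
  have mv: "mv_return M n r \<omega> = w \<bullet> r \<omega>" if "\<omega> \<in> space M" for \<omega>
  proof -
    have r: "r \<omega> \<in> carrier_vec n" using returns_carrier[OF \<phi> that] .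
    show ?thesis
      using symmetric_form[OF VR_inv(3) transpose_mat_inv[OF VR_carrier VR_sym VR_det] m r] r w
      by (simp add: mv_return_def mean_returns[OF \<phi>] cov_returns[OF \<phi>] m_def[symmetric]
          w_def[symmetric] comm_scalar_prod[of _ n])
  qed
  have "expectation (mv_return M n r) = expectation (\<lambda>\<omega>. w \<bullet> r \<omega>)"
    using mv by (intro Bochner_Integration.integral_cong) auto
  then have e: "expectation (mv_return M n r) = m \<bullet> w"
    using expectation_returns[OF \<phi> w] s by (simp add: m_def)
  have "covariance M (mv_return M n r) (mv_return M n r)
      = covariance M (\<lambda>\<omega>. w \<bullet> r \<omega>) (\<lambda>\<omega>. w \<bullet> r \<omega>)"
    using mv by (intro covariance_cong) auto
  also have "\<dots> = m \<bullet> w" by (simp add: covariance_returns[OF \<phi> w w] VRw s)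
  \<comment> \<open>Mean and variance are both \<open>m \<bullet> w\<close>, so the ratio is
    \<open>m \<bullet> w\<close>; this includes the value 0, because division by 0 yields 0.\<close>
  finally show "squared_sharpe M (mv_return M n r) = m \<bullet> (mat_inv VR *\<^sub>v m)"
    by (simp add: squared_sharpe_covariance e w_def power2_eq_square)
  define z where "z = transpose_mat B *\<^sub>v w"
  have z: "z \<in> carrier_vec K" using B_carrier w by (simp add: z_def)
  have zS: "z \<bullet> (Sf *\<^sub>v z) \<le> m \<bullet> w"
    using VR_form_ge[OF w] by (simp add: z_def VRw s)
  with pos_def_mat_psd[OF Sf_pos_def z] show nonneg: "0 \<le> m \<bullet> (mat_inv VR *\<^sub>v m)"
    by (simp add: w_def)
  define y where "y = mat_inv Sf *\<^sub>v (\<mu> + \<phi>)"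
  have y: "y \<in> carrier_vec K"
    using mat_inv_inverts(3)[OF Sf_carrier(1) Sf_det] lam by (simp add: y_def)
  have Sy: "Sf *\<^sub>v y = \<mu> + \<phi>"
    using mat_inv_mult_vec[OF Sf_carrier(1) Sf_det lam] by (simp add: y_def)
  have zl: "z \<bullet> (\<mu> + \<phi>) = m \<bullet> w"
    using transpose_vec_mult_scalar[OF B_carrier lam w] s by (simp add: z_def m_def)
  have c: "0 \<le> y \<bullet> (\<mu> + \<phi>)" using pos_def_mat_psd[OF Sf_pos_def y] by (simp add: Sy)
  have "(m \<bullet> w)\<^sup>2 \<le> (z \<bullet> (Sf *\<^sub>v z)) * (y \<bullet> (\<mu> + \<phi>))"
    using psd_Cauchy_Schwarz[OF Sf_carrier pos_def_mat_psd[OF Sf_pos_def] z y] by (simp add: Sy zl)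
  also have "\<dots> \<le> (m \<bullet> w) * (y \<bullet> (\<mu> + \<phi>))"
    using zS c by (rule mult_right_mono)
  \<comment> \<open>A factor \<open>m \<bullet> w\<close> is cancelled when it is nonzero; when it
    is 0, the claim is just \<open>c\<close>.\<close>
  finally have "m \<bullet> w \<le> y \<bullet> (\<mu> + \<phi>)"
    using nonneg c by (cases "m \<bullet> w = 0") (simp_all add: power2_eq_square w_def)
  then show "m \<bullet> (mat_inv VR *\<^sub>v m) \<le> (\<mu> + \<phi>) \<bullet> (mat_inv Sf *\<^sub>v (\<mu> + \<phi>))"
    using comm_scalar_prod[OF y lam] by (simp add: w_def y_def)
qed

section \<open>The phi-portfolio\<close>

lemma info_psd:
  assumes x: "x \<in> carrier_vec K"
  shows "0 \<le> x \<bullet> (info_mat B Vu *\<^sub>v x)"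
proof -
  \<comment> \<open>In terms of \<open>v\<close> the form becomes \<open>v \<bullet> Vu v\<close>,
    so definiteness of \<open>Vu\<close> can be used directly instead of that of its
    inverse.\<close>
  define v where "v = mat_inv Vu *\<^sub>v (B *\<^sub>v x)"
  have Bx: "B *\<^sub>v x \<in> carrier_vec n" using B_carrier x by simp
  have v: "v \<in> carrier_vec n" using Vu_inv(3) Bx by (simp add: v_def)
  have "x \<bullet> (info_mat B Vu *\<^sub>v x) = v \<bullet> (B *\<^sub>v x)"
    using transpose_vec_mult_scalar[OF B_carrier x v] B_carrier v x
    by (simp add: info_mult_vec v_def[symmetric] comm_scalar_prod[of x K])
  also have "\<dots> = v \<bullet> (Vu *\<^sub>v v)"
    using mat_inv_mult_vec[OF Vu_carrier(1) Vu_det Bx] by (simp add: v_def)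
  finally show ?thesis using pos_def_mat_psd[OF Vu_pos_def v] by simp
qed

lemma squared_sharpe_phi:
  assumes \<phi>: "\<phi> \<in> carrier_vec K"
  shows "squared_sharpe M (phi_return \<phi> B Vu f r)
    = (\<phi> \<bullet> \<phi>)\<^sup>2 / (\<phi> \<bullet> (mat_inv (info_mat B Vu) *\<^sub>v \<phi>))"
proof -
  define A where "A = info_mat B Vu"
  have A: "A \<in> carrier_mat K K" "transpose_mat A = A" "det A \<noteq> 0"
    using info_carrier info_symmetric info_det by (auto simp: A_def)
  have Ai: "mat_inv A \<in> carrier_mat K K" using mat_inv_inverts(3)[OF A(1,3)] .
  define y where "y = mat_inv A *\<^sub>v \<phi>"
  have y: "y \<in> carrier_vec K" using Ai \<phi> by (simp add: y_def)
  define w where "w = mat_inv Vu *\<^sub>v (B *\<^sub>v y)"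
  have By: "B *\<^sub>v y \<in> carrier_vec n" using B_carrier y by simp
  have w: "w \<in> carrier_vec n" using Vu_inv(3) By by (simp add: w_def)
  \<comment> \<open>The factor exposure is exactly \<open>\<phi>\<close>: this cancels the
    subtracted \<open>\<phi> \<bullet> f \<omega>\<close> in \<open>ret\<close> and leaves the mean
    \<open>\<phi> \<bullet> \<phi>\<close>.\<close>
  have Btw: "transpose_mat B *\<^sub>v w = \<phi>"
    using mat_inv_mult_vec(1)[OF A(1,3) \<phi>] info_mult_vec[OF y] by (simp add: w_def A_def y_def)
  have W: "\<phi> \<bullet> ((mat_inv A * transpose_mat B * mat_inv Vu) *\<^sub>v x) = w \<bullet> x"
    if x: "x \<in> carrier_vec n" for x
  proof -
    have vx: "mat_inv Vu *\<^sub>v x \<in> carrier_vec n" using Vu_inv(3) x by simp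
    have bx: "transpose_mat B *\<^sub>v (mat_inv Vu *\<^sub>v x) \<in> carrier_vec K"
      using B_carrier vx by simp
    have "(mat_inv A * transpose_mat B * mat_inv Vu) *\<^sub>v x
        = mat_inv A *\<^sub>v (transpose_mat B *\<^sub>v (mat_inv Vu *\<^sub>v x))"
      using Ai B_carrier Vu_inv(3) x vx
      by (simp add: assoc_mult_mat_vec[of _ K n _ n] assoc_mult_mat_vec[of _ K K _ n])
    then have "\<phi> \<bullet> ((mat_inv A * transpose_mat B * mat_inv Vu) *\<^sub>v x)
        = (transpose_mat B *\<^sub>v (mat_inv Vu *\<^sub>v x)) \<bullet> y"
      using symmetric_form[OF Ai transpose_mat_inv[OF A] \<phi> bx] by (simp add: y_def)
    also have "\<dots> = (mat_inv Vu *\<^sub>v x) \<bullet> (B *\<^sub>v y)"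
      using transpose_vec_mult_scalar[OF B_carrier y vx] .
    also have "\<dots> = (B *\<^sub>v y) \<bullet> (mat_inv Vu *\<^sub>v x)" using vx By by (rule comm_scalar_prod)
    also have "\<dots> = x \<bullet> w"
      using symmetric_form[OF Vu_inv(3) transpose_mat_inv[OF Vu_carrier Vu_det] By x]
      by (simp add: w_def)
    also have "\<dots> = w \<bullet> x" using x w by (rule comm_scalar_prod)
    finally show ?thesis .
  qed
  have ret: "phi_return \<phi> B Vu f r \<omega> = \<phi> \<bullet> \<phi> + w \<bullet> u \<omega>" if \<omega>: "\<omega> \<in> space M" for \<omega>
  proof -
    have r: "r \<omega> \<in> carrier_vec n" using returns_carrier[OF \<phi> \<omega>] .
    have "w \<bullet> (B *\<^sub>v \<phi>) = \<phi> \<bullet> \<phi>"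
      using transpose_vec_mult_scalar[OF B_carrier \<phi> w] by (simp add: Btw)
    then have wr: "w \<bullet> r \<omega> = \<phi> \<bullet> \<phi> + (\<phi> \<bullet> f \<omega> + w \<bullet> u \<omega>)"
      using scalar_prod_returns[OF \<phi> w \<omega>] by (simp add: Btw)
    have "phi_return \<phi> B Vu f r \<omega>
        = \<phi> \<bullet> ((mat_inv A * transpose_mat B * mat_inv Vu) *\<^sub>v r \<omega>) - \<phi> \<bullet> f \<omega>"
      unfolding phi_return_def A_def[symmetric] using Ai B_carrier Vu_inv(3) r f_carrier[OF \<omega>] \<phi>
      by (intro scalar_prod_minus_distrib[of _ K]) (auto intro!: mult_mat_vec_carrier)
    with W[OF r] wr show ?thesis by simp
  qed
  have sq: "square_integrable M (\<lambda>\<omega>. w \<bullet> u \<omega>)"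
    using square_integrable_scalar_prod[OF u_random] .
  have "expectation (phi_return \<phi> B Vu f r) = expectation (\<lambda>\<omega>. \<phi> \<bullet> \<phi> + w \<bullet> u \<omega>)"
    using ret by (intro Bochner_Integration.integral_cong) auto
  then have e: "expectation (phi_return \<phi> B Vu f r) = \<phi> \<bullet> \<phi>"
    using square_integrable_integrable[OF sq] w
    by (simp add: expectation_scalar_prod[OF u_random] u_mean prob_space)
  have shift: "covariance M (\<lambda>\<omega>. \<phi> \<bullet> \<phi> + w \<bullet> u \<omega>) Z = covariance M (\<lambda>\<omega>. w \<bullet> u \<omega>) Z"
    if "square_integrable M Z" for Z
    using that sq by (simp add: covariance_add_left square_integrable_const covariance_const_left)
  have "covariance M (phi_return \<phi> B Vu f r) (phi_return \<phi> B Vu f r)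
      = covariance M (\<lambda>\<omega>. \<phi> \<bullet> \<phi> + w \<bullet> u \<omega>) (\<lambda>\<omega>. \<phi> \<bullet> \<phi> + w \<bullet> u \<omega>)"
    using ret by (intro covariance_cong) auto
  also have "\<dots> = covariance M (\<lambda>\<omega>. w \<bullet> u \<omega>) (\<lambda>\<omega>. \<phi> \<bullet> \<phi> + w \<bullet> u \<omega>)"
    using sq by (intro shift square_integrable_add square_integrable_const)
  also have "\<dots> = covariance M (\<lambda>\<omega>. w \<bullet> u \<omega>) (\<lambda>\<omega>. w \<bullet> u \<omega>)"
    using shift[OF sq] by (simp add: covariance_commute)
  also have "\<dots> = w \<bullet> (Vu *\<^sub>v w)"
    using covariance_scalar_prods_cov_mat[OF u_random w] by (simp add: u_cov)
  also have "\<dots> = w \<bullet> (B *\<^sub>v y)"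
    using mat_inv_mult_vec(1)[OF Vu_carrier(1) Vu_det By] by (simp add: w_def)
  also have "\<dots> = \<phi> \<bullet> y"
    using transpose_vec_mult_scalar[OF B_carrier y w] by (simp add: Btw)
  finally show ?thesis by (simp add: squared_sharpe_covariance e y_def A_def)
qed

text \<open>The Rayleigh bound is used for \<open>A\<close> at \<open>y = A^-1 \<phi>\<close>, which
  avoids the spectrum of the inverse. Combined with Cauchy--Schwarz for \<open>y\<close> and
  \<open>\<phi>\<close>, it bounds the variance \<open>y \<bullet> \<phi>\<close>.\<close>

lemma squared_sharpe_phi_ge:
  assumes \<phi>: "\<phi> \<in> carrier_vec K" and K: "0 < K" and pos: "0 < \<phi> \<bullet> \<phi>"
  shows "(\<phi> \<bullet> \<phi>) * lambda_min (info_mat B Vu) \<le> squared_sharpe M (phi_return \<phi> B Vu f r)"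
proof -
  define A where "A = info_mat B Vu"
  have A: "A \<in> carrier_mat K K" "transpose_mat A = A" "det A \<noteq> 0"
    using info_carrier info_symmetric info_det by (auto simp: A_def)
  define y where "y = mat_inv A *\<^sub>v \<phi>"
  have y: "y \<in> carrier_vec K" using mat_inv_inverts(3)[OF A(1,3)] \<phi> by (simp add: y_def)
  have Ay: "A *\<^sub>v y = \<phi>" using mat_inv_mult_vec(1)[OF A(1,3) \<phi>] by (simp add: y_def)
  have nonneg: "0 \<le> y \<bullet> \<phi>" using info_psd[OF y] by (simp add: A_def[symmetric] Ay)
  have CS: "(y \<bullet> \<phi>)\<^sup>2 \<le> (y \<bullet> y) * (\<phi> \<bullet> \<phi>)"
    using psd_Cauchy_Schwarz[of "1\<^sub>m K" K y \<phi>] y \<phi> scalar_prod_self_nonneg by simp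
  \<comment> \<open>A second Cauchy--Schwarz, now for the form of \<open>A\<close>, excludes zero
    variance, for which the quotient would take the default value 0.\<close>
  have "(\<phi> \<bullet> \<phi>)\<^sup>2 \<le> (y \<bullet> \<phi>) * (\<phi> \<bullet> (A *\<^sub>v \<phi>))"
    using psd_Cauchy_Schwarz[OF A(1,2) info_psd[folded A_def] \<phi> y] \<phi> y Ay
    by (simp add: mult.commute)
  with pos have "y \<bullet> \<phi> \<noteq> 0" by auto
  with nonneg have yp: "0 < y \<bullet> \<phi>" by simp
  have ray: "lambda_min A * (y \<bullet> y) \<le> y \<bullet> \<phi>"
    using lambda_min_le_quadratic_form[OF A(1,2) K y] by (simp add: Ay)
  have "lambda_min A * (y \<bullet> \<phi>) \<le> \<phi> \<bullet> \<phi>"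
  \<comment> \<open>\<open>CS\<close> may be multiplied by \<open>lambda_min A\<close> only if that
    is nonnegative; otherwise the left side is nonpositive and the claim is immediate.\<close>
  proof (cases "0 \<le> lambda_min A")
    case True
    have "lambda_min A * (y \<bullet> \<phi>) * (y \<bullet> \<phi>) \<le> lambda_min A * ((y \<bullet> y) * (\<phi> \<bullet> \<phi>))"
      using mult_left_mono[OF CS True] by (simp add: power2_eq_square mult.assoc)
    also have "\<dots> \<le> (\<phi> \<bullet> \<phi>) * (y \<bullet> \<phi>)"
      using mult_right_mono[OF ray, of "\<phi> \<bullet> \<phi>"] pos by (simp add: mult_ac)
    finally show ?thesis using yp by simp
  next
    case False
    with yp have "lambda_min A * (y \<bullet> \<phi>) \<le> 0" by (simp add: mult_nonpos_nonneg)
    with pos show ?thesis by simp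
  qed
  then have "(\<phi> \<bullet> \<phi>) * (lambda_min A * (y \<bullet> \<phi>)) \<le> (\<phi> \<bullet> \<phi>) * (\<phi> \<bullet> \<phi>)"
    using pos by (intro mult_left_mono) auto
  then have "(\<phi> \<bullet> \<phi>) * lambda_min A \<le> (\<phi> \<bullet> \<phi>)\<^sup>2 / (y \<bullet> \<phi>)"
    using yp by (simp add: field_simps power2_eq_square)
  then show ?thesis
    using comm_scalar_prod[OF y \<phi>] by (simp add: squared_sharpe_phi[OF \<phi>] A_def y_def)
qed

end

text \<open>The model is imposed only from \<open>n0\<close> on: an invertible information matrix
  forces \<open>n \<ge> K\<close>, so small \<open>n\<close> must be excluded. The probability space
  and the factors may change with \<open>n\<close>, while the factor moments stay fixed.\<close>

theorem mainTheorem2: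
  fixes M :: "nat \<Rightarrow> 'a measure"
    and K n0 :: nat
    and \<phi> \<mu> :: "real vec" and Sf :: "real mat"
    and B Vu :: "nat \<Rightarrow> real mat"
    and f u r :: "nat \<Rightarrow> 'a \<Rightarrow> real vec"
  assumes "K \<ge> 1"
    and "\<phi> \<in> carrier_vec K" and "\<phi> \<bullet> \<phi> > 0"
    and "\<And>n. n \<ge> n0 \<Longrightarrow> factor_model (M n) n K \<phi> \<mu> Sf (B n) (Vu n) (f n) (u n) (r n)"
  shows
    "let lam = \<mu> + \<phi>;
         A = (\<lambda>n. info_mat (B n) (Vu n));
         muR = (\<lambda>n. B n *\<^sub>v lam);
         VR = (\<lambda>n. B n * Sf * transpose_mat (B n) + Vu n);
         SRphi = (\<lambda>n. squared_sharpe (M n) (phi_return \<phi> (B n) (Vu n) (f n) (r n)));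
         SRmv = (\<lambda>n. squared_sharpe (M n) (mv_return (M n) n (r n)))
     in (\<forall>n\<ge>n0.
           SRphi n = (\<phi> \<bullet> \<phi>)\<^sup>2 / (\<phi> \<bullet> (mat_inv (A n) *\<^sub>v \<phi>)) \<and>
           SRphi n \<ge> (\<phi> \<bullet> \<phi>) * lambda_min (A n) \<and>
           mean_vec (M n) n (r n) = muR n \<and>
           cov_mat (M n) n (r n) = VR n \<and>
           SRmv n = muR n \<bullet> (mat_inv (VR n) *\<^sub>v muR n) \<and>
           SRmv n \<le> lam \<bullet> (mat_inv Sf *\<^sub>v lam)) \<and>
        (filterlim (\<lambda>n. lambda_min (A n)) at_top sequentially \<longrightarrow>
           filterlim SRphi at_top sequentially \<and>
           bounded (SRmv ` {n0..}) \<and>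
           (\<forall>\<^sub>F n in sequentially. SRphi n > SRmv n))"
proof -
  define lam where "lam = \<mu> + \<phi>"
  define A where "A n = info_mat (B n) (Vu n)" for n
  define muR where "muR n = B n *\<^sub>v lam" for n
  define VR where "VR n = B n * Sf * transpose_mat (B n) + Vu n" for n
  define SRphi where "SRphi n = squared_sharpe (M n) (phi_return \<phi> (B n) (Vu n) (f n) (r n))" for n
  define SRmv where "SRmv n = squared_sharpe (M n) (mv_return (M n) n (r n))" for n
  define c where "c = lam \<bullet> (mat_inv Sf *\<^sub>v lam)"
  note defs = lam_def A_def muR_def VR_def SRphi_def SRmv_def c_def
  \<comment> \<open>The extra fact \<open>nonneg\<close> is the lower half of boundedness of
    \<open>SRmv\<close>; the constant \<open>c\<close>, free of \<open>n\<close>, is the upper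
    half.\<close>
  have each: "SRphi n = (\<phi> \<bullet> \<phi>)\<^sup>2 / (\<phi> \<bullet> (mat_inv (A n) *\<^sub>v \<phi>)) \<and>
      SRphi n \<ge> (\<phi> \<bullet> \<phi>) * lambda_min (A n) \<and>
      mean_vec (M n) n (r n) = muR n \<and>
      cov_mat (M n) n (r n) = VR n \<and>
      SRmv n = muR n \<bullet> (mat_inv (VR n) *\<^sub>v muR n) \<and>
      SRmv n \<le> c" and nonneg: "0 \<le> SRmv n" if "n0 \<le> n" for n
  proof -
    interpret factor_model "M n" n K \<phi> \<mu> Sf "B n" "Vu n" "f n" "u n" "r n"
      using assms(4)[OF that] .
    have K: "0 < K" using assms(1) by simp
    note facts = squared_sharpe_phi[OF assms(2)] squared_sharpe_phi_ge[OF assms(2) K assms(3)]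
      mean_returns[OF assms(2)] cov_returns[OF assms(2)] squared_sharpe_mv[OF assms(2)]
    show "SRphi n = (\<phi> \<bullet> \<phi>)\<^sup>2 / (\<phi> \<bullet> (mat_inv (A n) *\<^sub>v \<phi>)) \<and>
        SRphi n \<ge> (\<phi> \<bullet> \<phi>) * lambda_min (A n) \<and>
        mean_vec (M n) n (r n) = muR n \<and>
        cov_mat (M n) n (r n) = VR n \<and>
        SRmv n = muR n \<bullet> (mat_inv (VR n) *\<^sub>v muR n) \<and>
        SRmv n \<le> c"
      unfolding defs using facts[unfolded VR_def] by metis
    show "0 \<le> SRmv n"
      unfolding SRmv_def using facts by metis
  qed
  have SRmv_le: "SRmv n \<le> c" if "n0 \<le> n" for n
    using each[OF that] by blast
  then have bdd: "bounded (SRmv ` {n0..})"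
    using nonneg by (intro boundedI[of _ c]) auto
  have limits: "filterlim SRphi at_top sequentially \<and> (\<forall>\<^sub>F n in sequentially. SRphi n > SRmv n)"
    if "filterlim (\<lambda>n. lambda_min (A n)) at_top sequentially"
  proof
    have "filterlim (\<lambda>n. (\<phi> \<bullet> \<phi>) * lambda_min (A n)) at_top sequentially"
      using tendsto_const assms(3) that by (rule filterlim_tendsto_pos_mult_at_top)
    then show lim: "filterlim SRphi at_top sequentially"
      by (rule filterlim_at_top_mono)
        (use each in \<open>auto simp: eventually_sequentially\<close>)
    \<comment> \<open>The comparison passes through the uniform bound \<open>c\<close> for
      \<open>SRmv\<close>, so no limit of \<open>SRmv\<close> is involved.\<close>
    have "\<forall>\<^sub>F n in sequentially. c < SRphi n"
      using lim by (simp add: filterlim_at_top_dense)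
    then show "\<forall>\<^sub>F n in sequentially. SRphi n > SRmv n"
      using eventually_ge_at_top[of n0] by eventually_elim (use SRmv_le in force)
  qed
  show ?thesis
    unfolding Let_def
    using each bdd limits unfolding defs by blast
qed

end
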